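(* For each $n$ let $V_n=(v_{nj}(x_i^{n}))_{i,j=0}^{n-1}$ be a unitary generalized trigonometric Vandermonde matrix, let $U_n=V_n^*$, and let $L_n[U_n]$ be the associated sequence of positive linear operators on $C[0,2\pi]$, with $\|L_n[U_n]\|\le 1$. Let $g_1,\dots,g_m$ be real-valued continuous functions such that for every $g$ in the finite set $\{g_1,\dots,g_m,\sum_{k=1}^m g_k^2\}$ one has $L_n[U_n](g)=g+\epsilon_n(g)$, where $\epsilon_n(g)$ converges uniformly to $0$ as $n\to\infty$. Then $P_{U_n}(A_n(f))$ converges to $A_n(f)$ in weak cluster for every $f$ in the $C^*$-algebra generated by $\{g_1,\dots,g_m\}$.
   Context: Toeplitz matrices: for $f\in C[0,2\pi]$, $A_n(f)$ is the $n\times n$ matrix with entries $(A_n(f))_{j,k}=a_{j-k}$, $a_k=\frac1{2\pi}\int_0^{2\pi}f(x)e^{-ikx}\,dx$. Vandermonde matrices: for each $n$ let $v_{n0},\dots,v_{n,n-1}$ be trigonometric functions (trigonometric polynomials) and let $\{x_0^n,\dots,x_{n-1}^n\}$ be a grid of $n$ points in an interval $I\subseteq[0,2\pi]$ such that the matrix $V_n=(v_{nj}(x_i^n))_{i,j=0}^{n-1}$ is unitary. Put $U_n=V_n^*$. LPO: with the row vector $v(x)=(v_{n0}(x),\dots,v_{n,n-1}(x))$ (whose value at $x_j^n$ is the $j$-th row of $U_n^*$), define $L_n[U_n](f)(x)=v(x)A_n(f)v(x)^*$ for $f\in C[0,2\pi]$, $x\in[0,2\pi]$; $v(x)^*$ is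 the conjugate transpose. It is a standing assumption that these positive linear maps have norm at most $1$ on $C[0,2\pi]$ with the sup norm. Preconditioner: $P_{U_n}(X)=U_n\,\sigma(U_n^*XU_n)\,U_n^*$, where $\sigma(Y)$ is the diagonal part of $Y$; this is the Frobenius-norm best approximation of $X$ in $\{X\in M_n(\mathbb{C}): U_n^*XU_n\text{ diagonal}\}$. Thus the eigenvalues of $P_{U_n}(A_n(f))$ are the numbers $L_n[U_n](f)(x_j^n)$, $0\le j\le n-1$. Weak cluster: for sequences $\{X_n\},\{Y_n\}$ of $n\times n$ matrices, $X_n$ converges to $Y_n$ in weak cluster if for every $\epsilon>0$ there exist numbers $N_{1,\epsilon}(n)=o(n)$ and an integer $N_{2,\epsilon}$ such that for all $n>N_{2,\epsilon}$ all singular values of $X_n-Y_n$ lie in $[0,\epsilon)$ except for at most $N_{1,\epsilon}(n)$ of them (with multiplicity). *)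

theory Defs
  imports
    "HOL-Analysis.Analysis"
    "HOL-Library.Landau_Symbols"
    "Jordan_Normal_Form.Schur_Decomposition"
begin

text \<open>
  Elements of \<open>C[0,2\<pi>]\<close> are represented by total functions on the reals of which only
  the restriction to the closed interval matters. They are complex-valued, and \<open>f(0) = f(2\<pi>)\<close>
  is not required.
\<close>

definition C2pi :: "(real \<Rightarrow> complex) set" where
  "C2pi = {f. continuous_on {0..2*pi} f}"

definition sup_norm :: "(real \<Rightarrow> complex) \<Rightarrow> real" where
  "sup_norm f = (SUP t\<in>{0..2*pi}. cmod (f t))"

text \<open>
  Unital norm-closed star-subalgebras of \<open>C[0,2\<pi>]\<close>. The closure condition also makes such a set
  invariant under changing a function outside \<open>[0,2\<pi>]\<close>. The algebra generated by a set is taken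
  inside the unital algebra \<open>C[0,2\<pi>]\<close>, so it contains the constants; it includes the smallest
  closed star-subalgebra containing the generators, without the demand for a unit.
\<close>

definition cstar_subalgebra :: "(real \<Rightarrow> complex) set \<Rightarrow> bool" where
  "cstar_subalgebra B \<longleftrightarrow>
     B \<subseteq> C2pi \<and>
     (\<lambda>_. 1) \<in> B \<and>
     (\<forall>f\<in>B. \<forall>h\<in>B. (\<lambda>t. f t + h t) \<in> B) \<and>
     (\<forall>c. \<forall>f\<in>B. (\<lambda>t. c * f t) \<in> B) \<and>
     (\<forall>f\<in>B. \<forall>h\<in>B. (\<lambda>t. f t * h t) \<in> B) \<and>
     (\<forall>f\<in>B. (\<lambda>t. cnj (f t)) \<in> B) \<and>
     (\<forall>f\<in>C2pi. (\<forall>\<epsilon>>0. \<exists>h\<in>B. sup_norm (\<lambda>t. f t - h t) < \<epsilon>) \<longrightarrow> f \<in> B)"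

definition cstar_generated :: "(real \<Rightarrow> complex) set \<Rightarrow> (real \<Rightarrow> complex) set" where
  "cstar_generated S = cstar_subalgebra hull S"

definition fourier_coeff :: "(real \<Rightarrow> complex) \<Rightarrow> int \<Rightarrow> complex" where
  "fourier_coeff f k =
     integral {0..2*pi} (\<lambda>t. f t * exp (- (\<i> * of_int k * of_real t))) / of_real (2*pi)"

definition toeplitz :: "nat \<Rightarrow> (real \<Rightarrow> complex) \<Rightarrow> complex mat" where
  "toeplitz n f = Matrix.mat n n (\<lambda>(j,k). fourier_coeff f (int j - int k))"

definition trig_poly :: "(real \<Rightarrow> complex) \<Rightarrow> bool" where
  "trig_poly p \<longleftrightarrow>
     (\<exists>(N::nat) c. \<forall>t. p t = (\<Sum>k=-int N..int N. c k * exp (\<i> * of_int k * of_real t)))"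

definition unitary_mat :: "complex mat \<Rightarrow> bool" where
  "unitary_mat M \<longleftrightarrow>
     square_mat M \<and> mat_adjoint M * M = 1\<^sub>m (dim_row M) \<and> M * mat_adjoint M = 1\<^sub>m (dim_row M)"

text \<open>Below, \<open>w\<close> is the family \<open>v\<^sub>n\<^sub>0, \<dots>, v\<^sub>n\<^sub>,\<^sub>n\<^sub>-\<^sub>1\<close> and \<open>y\<close> the grid for a fixed \<open>n\<close>.\<close>

definition vandermonde :: "nat \<Rightarrow> (nat \<Rightarrow> real \<Rightarrow> complex) \<Rightarrow> (nat \<Rightarrow> real) \<Rightarrow> complex mat" where
  "vandermonde n w y = Matrix.mat n n (\<lambda>(i,j). w j (y i))"

definition row_fun :: "nat \<Rightarrow> (nat \<Rightarrow> real \<Rightarrow> complex) \<Rightarrow> real \<Rightarrow> complex Matrix.vec" where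
  "row_fun n w t = Matrix.vec n (\<lambda>j. w j t)"

definition LPO :: "nat \<Rightarrow> (nat \<Rightarrow> real \<Rightarrow> complex) \<Rightarrow> (real \<Rightarrow> complex) \<Rightarrow> real \<Rightarrow> complex" where
  "LPO n w f t = scalar_prod (row_fun n w t) (toeplitz n f *\<^sub>v conjugate (row_fun n w t))"

definition diag_part :: "complex mat \<Rightarrow> complex mat" where
  "diag_part Y = Matrix.mat (dim_row Y) (dim_col Y) (\<lambda>(i,j). if i = j then Y $$ (i,j) else 0)"

definition precond :: "complex mat \<Rightarrow> complex mat \<Rightarrow> complex mat" where
  "precond U X = U * diag_part (mat_adjoint U * X * U) * mat_adjoint U"

text \<open>
  Singular values with multiplicity: the square roots of the eigenvalues of \<open>X\<^sup>* X\<close>,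
  which are real and nonnegative, so \<open>Re\<close> only changes the type.
\<close>

definition singular_values :: "complex mat \<Rightarrow> real multiset" where
  "singular_values X = image_mset (\<lambda>z. sqrt (Re z)) (proots (char_poly (mat_adjoint X * X)))"

definition weak_cluster :: "(nat \<Rightarrow> complex mat) \<Rightarrow> (nat \<Rightarrow> complex mat) \<Rightarrow> bool" where
  "weak_cluster X Y \<longleftrightarrow>
     (\<forall>\<epsilon>>0. \<exists>(N1 :: nat \<Rightarrow> nat) (N2 :: nat). (\<lambda>n. real (N1 n)) \<in> o(\<lambda>n. real n) \<and>
        (\<forall>n>N2. size {#s \<in># singular_values (X n - Y n). s \<notin> {0..<\<epsilon>}#} \<le> N1 n))"

end

theory Submission
  imports Defs
begin

text \<open>
  The operator \<open>L\<^sub>n\<close> evaluated at a grid point \<open>y = x\<^sub>j\<^sup>n\<close> is a state on \<open>C[0,2\<pi>]\<close>: it integrates against a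
  nonnegative density (lemma \<open>toeplitz_quadratic_form\<close>), and it fixes the constants since the
  \<open>j\<close>-th row of the unitary matrix \<open>V\<^sub>n\<close> has norm one. Call a function \<open>f\<close> concentrated if
  \<open>L\<^sub>n(|f - f(y)|\<^sup>2)(y)\<close> tends to zero uniformly over the grid points \<open>y\<close>. Two facts prove the theorem.

  The concentrated functions form a unital closed star-subalgebra (lemma
  \<open>cstar_subalgebra_concentrated\<close>), by elementary pointwise inequalities that positivity transfers
  to the states. By Korovkin's expansion of a square, convergence on the test functions
  \<open>g\<^sub>1, \<dots>, g\<^sub>m, \<Sum> g\<^sub>k\<^sup>2\<close> makes every \<open>g\<^sub>k\<close> concentrated (lemma \<open>generators_concentrated\<close>). Hence the whole
  generated algebra consists of concentrated functions.

  For a concentrated \<open>f\<close> the preconditioning error is, up to sign and a unitary change of basis, the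
  off-diagonal part of \<open>V\<^sub>n A\<^sub>n(f) V\<^sub>n\<^sup>*\<close>. In the row of \<open>y\<close> this off-diagonal part does not change when
  \<open>f\<close> is replaced by \<open>f - f(y)\<close>, and Bessel's inequality bounds the squared norm of that row by
  \<open>L\<^sub>n(|f - f(y)|\<^sup>2)(y)\<close> (lemmas \<open>offdiag_row_bound\<close> and \<open>toeplitz_row_bound\<close>). So the squared Frobenius norm of
  the error is \<open>o(n)\<close>, and at most \<open>o(n)\<close> singular values can reach a given \<open>\<epsilon> > 0\<close> (lemma
  \<open>singular_values_count_le\<close>).
\<close>

section \<open>Fourier coefficients and Bessel's inequality\<close>

text \<open>
  The average over one period is taken with values in any Banach space because it is applied
  to real functions, where it is monotone, and to complex ones, where it yields Fourier
  coefficients.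
\<close>

definition mean :: "(real \<Rightarrow> 'a::banach) \<Rightarrow> 'a" where
  "mean f = integral {0..2*pi} f /\<^sub>R (2*pi)"

lemma fourier_coeff_eq_mean:
  "fourier_coeff f k = mean (\<lambda>t. f t * exp (- (\<i> * of_int k * of_real t)))"
  unfolding fourier_coeff_def mean_def
  by (simp only: scaleR_conv_of_real of_real_inverse divide_inverse mult.commute[of "integral _ _"])

lemma mean_cong: "(\<And>t. t \<in> {0..2*pi} \<Longrightarrow> f t = g t) \<Longrightarrow> mean f = mean g"
  unfolding mean_def by (metis integral_cong)

lemma mean_add:
  assumes "continuous_on {0..2*pi} f" "continuous_on {0..2*pi} g"
  shows "mean (\<lambda>t. f t + g t) = mean f + mean g"
  unfolding mean_def using assms
  by (simp add: integral_add integrable_continuous_interval scaleR_add_right)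

lemma mean_diff:
  assumes "continuous_on {0..2*pi} f" "continuous_on {0..2*pi} g"
  shows "mean (\<lambda>t. f t - g t) = mean f - mean g"
  unfolding mean_def using assms
  by (simp add: integral_diff integrable_continuous_interval scaleR_diff_right)

lemma mean_sum:
  assumes "finite S" "\<And>k. k \<in> S \<Longrightarrow> continuous_on {0..2*pi} (f k)"
  shows "mean (\<lambda>t. \<Sum>k\<in>S. f k t) = (\<Sum>k\<in>S. mean (f k))"
  unfolding mean_def using assms
  by (simp add: integral_sum integrable_continuous_interval scaleR_sum_right)

lemma mean_mult_left:
  fixes c :: "'a :: {real_normed_field, banach}"
  shows "mean (\<lambda>t. c * f t) = c * mean f"
  unfolding mean_def by simp

lemma mean_of_real:
  assumes "continuous_on {0..2*pi} h"
  shows "mean (\<lambda>t. complex_of_real (h t)) = of_real (mean h)"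
proof -
  have "(h has_integral integral {0..2*pi} h) {0..2*pi}"
    using assms integrable_continuous_interval by blast
  from has_integral_of_real[OF this, where 'b = complex] show ?thesis
    unfolding mean_def by (simp add: integral_unique scaleR_conv_of_real)
qed

lemma mean_cnj: "mean (\<lambda>t. cnj (f t)) = cnj (mean f)"
  unfolding mean_def by (simp add: integral_cnj)

lemma mean_mono:
  fixes f g :: "real \<Rightarrow> real"
  assumes "continuous_on {0..2*pi} f" "continuous_on {0..2*pi} g"
    and "\<And>t. t \<in> {0..2*pi} \<Longrightarrow> f t \<le> g t"
  shows "mean f \<le> mean g"
  unfolding mean_def using assms
  by (auto intro!: mult_left_mono integral_le integrable_continuous_interval)

lemma fourier_coeff_exp:
  "fourier_coeff (\<lambda>t. exp (\<i> * of_int l * of_real t)) k = of_bool (k = l)"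
proof (cases "k = l")
  case True
  have "exp (\<i> * of_int l * of_real t) * exp (- (\<i> * of_int k * of_real t)) = 1" for t
    using True by (simp flip: exp_add)
  then show ?thesis
    using True by (simp add: fourier_coeff_def scaleR_conv_of_real)
next
  case False
  define c :: complex where "c = \<i> * of_int (l - k)"
  have c0: "c \<noteq> 0" using False by (simp add: c_def)
  have eq: "exp (\<i> * of_int l * of_real t) * exp (- (\<i> * of_int k * of_real t)) = exp (c * of_real t)" for t
    by (simp add: c_def algebra_simps flip: exp_add)
  have "((\<lambda>t. exp (c * of_real t)) has_integral
      exp (c * of_real (2*pi)) / c - exp (c * of_real 0) / c) {0..2*pi}"
  proof (rule fundamental_theorem_of_calculus)
    fix t assume "t \<in> {0..2*pi}"
    have "((\<lambda>z. exp (c * z) / c) has_field_derivative exp (c * of_real t)) (at (of_real t))"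
      using c0 by (auto intro!: derivative_eq_intros)
    then show "((\<lambda>t. exp (c * of_real t) / c) has_vector_derivative exp (c * of_real t)) (at t within {0..2*pi})"
      by (rule has_vector_derivative_real_field)
  qed simp
  moreover have "exp (c * of_real (2*pi)) = 1"
    using exp_integer_2pi[of "of_int (l - k)"] by (simp add: c_def mult_ac)
  ultimately show ?thesis
    using False unfolding fourier_coeff_def eq by (simp add: integral_unique)
qed

lemma continuous_on_exp_character [continuous_intros]:
  "continuous_on S (\<lambda>t. exp (- (\<i> * of_int k * complex_of_real t)))"
  by (intro continuous_intros)

lemma fourier_coeff_add:
  assumes "continuous_on {0..2*pi} f" "continuous_on {0..2*pi} g"
  shows "fourier_coeff (\<lambda>t. f t + g t) k = fourier_coeff f k + fourier_coeff g k"
  unfolding fourier_coeff_eq_mean distrib_right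
  by (intro mean_add continuous_intros assms)

lemma fourier_coeff_sum_mult:
  assumes "finite S" "\<And>l. l \<in> S \<Longrightarrow> continuous_on {0..2*pi} (f l)"
  shows "fourier_coeff (\<lambda>t. \<Sum>l\<in>S. c l * f l t) k = (\<Sum>l\<in>S. c l * fourier_coeff (f l) k)"
proof -
  have "fourier_coeff (\<lambda>t. \<Sum>l\<in>S. c l * f l t) k
      = mean (\<lambda>t. \<Sum>l\<in>S. c l * (f l t * exp (- (\<i> * of_int k * complex_of_real t))))"
    unfolding fourier_coeff_eq_mean sum_distrib_right mult.assoc ..
  also have "\<dots> = (\<Sum>l\<in>S. c l * fourier_coeff (f l) k)"
    by (subst mean_sum)
       (auto intro!: continuous_intros assms simp: mean_mult_left fourier_coeff_eq_mean)
  finally show ?thesis .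
qed

lemma fourier_coeff_const: "fourier_coeff (\<lambda>_. c) k = (if k = 0 then c else 0)"
proof -
  have "fourier_coeff (\<lambda>t. \<Sum>l\<in>{0}. c * exp (\<i> * of_int l * of_real t)) k = 
      (\<Sum>l\<in>{0}. c * fourier_coeff (\<lambda>t. exp (\<i> * of_int l * of_real t)) k)"
    by (rule fourier_coeff_sum_mult) (auto intro!: continuous_intros)
  then show ?thesis unfolding fourier_coeff_exp by auto
qed

text \<open>
  The trigonometric polynomial \<open>q\<close> with the Fourier coefficients of \<open>F\<close> on \<open>K\<close> is the orthogonal
  projection of \<open>F\<close>, and the two sides differ by the mean of \<open>|F - q|\<^sup>2\<close>.
\<close>

lemma bessel_inequality:
  assumes F: "continuous_on {0..2*pi} F" and K: "finite K"
  shows "(\<Sum>k\<in>K. (cmod (fourier_coeff F k))\<^sup>2) \<le> mean (\<lambda>t. (cmod (F t))\<^sup>2)"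
proof -
  define a where "a = fourier_coeff F"
  define q where "q = (\<lambda>t. \<Sum>k\<in>K. a k * exp (\<i> * of_int k * complex_of_real t))"
  have q: "continuous_on {0..2*pi} q"
    unfolding q_def by (intro continuous_intros)
  have aq: "fourier_coeff q k = a k" if "k \<in> K" for k
    unfolding q_def using K that
    by (subst fourier_coeff_sum_mult)
       (auto simp: fourier_coeff_exp of_bool_def if_distrib cong: if_cong intro!: continuous_intros)
  have pair: "mean (\<lambda>t. G t * cnj (q t)) = (\<Sum>k\<in>K. cnj (a k) * fourier_coeff G k)"
    if G: "continuous_on {0..2*pi} G" for G
  proof -
    have "mean (\<lambda>t. G t * cnj (q t))
        = mean (\<lambda>t. \<Sum>k\<in>K. cnj (a k) * (G t * exp (- (\<i> * of_int k * complex_of_real t))))"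
      unfolding q_def by (simp add: sum_distrib_left exp_cnj mult_ac)
    also have "\<dots> = (\<Sum>k\<in>K. cnj (a k) * fourier_coeff G k)"
      by (subst mean_sum)
         (auto intro!: continuous_intros G K simp: mean_mult_left fourier_coeff_eq_mean)
    finally show ?thesis .
  qed
  \<comment> \<open>The pairings of \<open>F\<close> with \<open>q\<close> and of \<open>q\<close> with itself have the same value \<open>s\<close>.\<close>
  define s where "s = (\<Sum>k\<in>K. (cmod (a k))\<^sup>2)"
  have s: "complex_of_real s = (\<Sum>k\<in>K. cnj (a k) * a k)"
    unfolding s_def by (simp add: complex_norm_square mult.commute del: of_real_power)
  have Fq: "mean (\<lambda>t. F t * cnj (q t)) = of_real s"
    using pair[OF F] s by (simp add: a_def)
  have qq: "mean (\<lambda>t. q t * cnj (q t)) = of_real s"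
    using pair[OF q] s aq by simp
  have qF: "mean (\<lambda>t. q t * cnj (F t)) = of_real s"
  proof -
    have "mean (\<lambda>t. cnj (F t * cnj (q t))) = cnj (of_real s)"
      by (simp only: mean_cnj Fq)
    then show ?thesis by (simp add: mult.commute)
  qed
  have "mean (\<lambda>t. complex_of_real ((cmod (F t - q t))\<^sup>2))
     = mean (\<lambda>t. complex_of_real ((cmod (F t))\<^sup>2) - F t * cnj (q t) - q t * cnj (F t) + q t * cnj (q t))"
    by (simp only: complex_norm_square) (simp add: algebra_simps)
  also have "\<dots> = mean (\<lambda>t. complex_of_real ((cmod (F t))\<^sup>2)) - of_real s"
    by (simp add: mean_add mean_diff continuous_intros F q Fq qF qq)
  finally have "complex_of_real (mean (\<lambda>t. (cmod (F t - q t))\<^sup>2)) =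
      of_real (mean (\<lambda>t. (cmod (F t))\<^sup>2) - s)"
    by (subst (asm) (1 2) mean_of_real) (auto intro!: continuous_intros F q)
  then have "mean (\<lambda>t. (cmod (F t - q t))\<^sup>2) = mean (\<lambda>t. (cmod (F t))\<^sup>2) - s"
    by (simp only: of_real_eq_iff)
  moreover have "mean (\<lambda>t. 0::real) \<le> mean (\<lambda>t. (cmod (F t - q t))\<^sup>2)"
    by (intro mean_mono continuous_intros F q) auto
  ultimately show ?thesis
    by (simp add: s_def a_def mean_def)
qed

section \<open>Quadratic forms of Toeplitz matrices\<close>

definition char_sum :: "nat \<Rightarrow> (nat \<Rightarrow> complex) \<Rightarrow> real \<Rightarrow> complex" where
  "char_sum n r t = (\<Sum>j<n. r j * exp (- (\<i> * of_int (int j) * of_real t)))"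

text \<open>
  For a row vector \<open>r\<close> this is the quadratic form \<open>r A\<^sub>n(h) r\<^sup>*\<close> of the Toeplitz matrix of a real
  \<open>h\<close>, written as the integral of \<open>h\<close> against a nonnegative density. This shape makes it evident
  that the form is positive and monotone in \<open>h\<close>.
\<close>

definition weighted_mean :: "nat \<Rightarrow> (nat \<Rightarrow> complex) \<Rightarrow> (real \<Rightarrow> real) \<Rightarrow> real" where
  "weighted_mean n r h = mean (\<lambda>t. h t * (cmod (char_sum n r t))\<^sup>2)"

lemma continuous_on_char_sum [continuous_intros]: "continuous_on S (char_sum n r)"
  unfolding char_sum_def by (intro continuous_intros)

lemma toeplitz_quadratic_form:
  assumes h: "continuous_on {0..2*pi} h"
  shows "(\<Sum>j<n. \<Sum>k<n. r j * fourier_coeff (\<lambda>t. of_real (h t)) (int j - int k) * cnj (r k))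
    = of_real (weighted_mean n r h)"
proof -
  have "complex_of_real (weighted_mean n r h)
     = mean (\<lambda>t. complex_of_real (h t * (cmod (char_sum n r t))\<^sup>2))"
    unfolding weighted_mean_def by (subst mean_of_real) (auto intro!: continuous_intros h)
  also have "\<dots> = mean (\<lambda>t. \<Sum>j<n. \<Sum>k<n. (r j * cnj (r k)) *
      (of_real (h t) * exp (- (\<i> * of_int (int j - int k) * complex_of_real t))))"
  proof (rule mean_cong)
    fix t
    have e: "exp (- (\<i> * of_int (int j - int k) * complex_of_real t)) =
      exp (- (\<i> * of_int (int j) * complex_of_real t)) * cnj (exp (- (\<i> * of_int (int k) * complex_of_real t)))" for j k
      by (simp add: exp_cnj algebra_simps flip: exp_add)
    show "complex_of_real (h t * (cmod (char_sum n r t))\<^sup>2) = (\<Sum>j<n. \<Sum>k<n. (r j * cnj (r k)) *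
      (of_real (h t) * exp (- (\<i> * of_int (int j - int k) * complex_of_real t))))"
      unfolding of_real_mult complex_norm_square e char_sum_def cnj_sum sum_product
      by (simp add: sum_distrib_left mult_ac)
  qed
  also have "\<dots> = (\<Sum>j<n. \<Sum>k<n. (r j * cnj (r k)) * fourier_coeff (\<lambda>t. of_real (h t)) (int j - int k))"
    unfolding fourier_coeff_eq_mean
    by (subst mean_sum, simp, intro continuous_intros h, intro sum.cong refl,
        subst mean_sum, simp, intro continuous_intros h, simp only: mean_mult_left)
  finally show ?thesis by (simp add: mult_ac)
qed

text \<open>
  The entries of the row \<open>r A\<^sub>n(f)\<close> are Fourier coefficients of the single function \<open>f \<cdot> char_sum n r\<close>,
  so Bessel's inequality bounds the norm of that row. In operator terms, \<open>A\<^sub>n(f) A\<^sub>n(f)\<^sup>*\<close> is dominated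
  by \<open>A\<^sub>n(|f|\<^sup>2)\<close>, because a Toeplitz matrix is the compression of a multiplication operator.
\<close>

lemma toeplitz_row_bound:
  assumes f: "continuous_on {0..2*pi} f"
  shows "(\<Sum>k<n. (cmod (\<Sum>j<n. r j * fourier_coeff f (int j - int k)))\<^sup>2)
    \<le> weighted_mean n r (\<lambda>t. (cmod (f t))\<^sup>2)"
proof -
  let ?F = "\<lambda>t. f t * char_sum n r t"
  have coeff: "(\<Sum>j<n. r j * fourier_coeff f (int j - int k)) = fourier_coeff ?F (- int k)" for k
  proof -
    have "fourier_coeff ?F (- int k)
        = mean (\<lambda>t. \<Sum>j<n. r j * (f t * exp (- (\<i> * of_int (int j - int k) * complex_of_real t))))"
      unfolding fourier_coeff_eq_mean
    proof (rule mean_cong)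
      fix t
      have e: "exp (- (\<i> * of_int (int j - int k) * complex_of_real t)) =
         exp (- (\<i> * of_int (int j) * complex_of_real t)) * exp (- (\<i> * of_int (- int k) * complex_of_real t))" for j
        by (simp add: algebra_simps flip: exp_add)
      show "f t * char_sum n r t * exp (- (\<i> * of_int (- int k) * complex_of_real t)) =
         (\<Sum>j<n. r j * (f t * exp (- (\<i> * of_int (int j - int k) * complex_of_real t))))"
        unfolding e char_sum_def sum_distrib_left sum_distrib_right by (simp add: mult_ac)
    qed
    also have "\<dots> = (\<Sum>j<n. r j * fourier_coeff f (int j - int k))"
      unfolding fourier_coeff_eq_mean
      by (subst mean_sum) (auto intro!: continuous_intros f simp: mean_mult_left)
    finally show ?thesis by simp
  qed
  have "(\<Sum>k<n. (cmod (fourier_coeff ?F (- int k)))\<^sup>2)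
      = (\<Sum>k\<in>(\<lambda>k. - int k) ` {..<n}. (cmod (fourier_coeff ?F k))\<^sup>2)"
    by (simp add: sum.reindex inj_on_def)
  also have "\<dots> \<le> mean (\<lambda>t. (cmod (?F t))\<^sup>2)"
    by (intro bessel_inequality continuous_intros f) auto
  finally show ?thesis
    unfolding coeff weighted_mean_def by (simp add: norm_mult power_mult_distrib)
qed

text \<open>
  The Toeplitz matrix of a constant is that multiple of the identity. Hence a row of norm one
  turns the weighted mean into a state.
\<close>

lemma weighted_mean_const: "weighted_mean n r (\<lambda>_. c) = c * (\<Sum>j<n. (cmod (r j))\<^sup>2)"
proof -
  have "complex_of_real (weighted_mean n r (\<lambda>_. c)) =
    (\<Sum>j<n. \<Sum>k<n. r j * (if int j - int k = 0 then of_real c else 0) * cnj (r k))"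
    unfolding toeplitz_quadratic_form[OF continuous_on_const, symmetric] fourier_coeff_const ..
  also have "\<dots> = (\<Sum>j<n. \<Sum>k<n. if k = j then of_real c * (r j * cnj (r j)) else 0)"
    by (intro sum.cong) auto
  also have "\<dots> = (\<Sum>j<n. of_real c * (r j * cnj (r j)))"
    by (simp)
  also have "\<dots> = of_real (c * (\<Sum>j<n. (cmod (r j))\<^sup>2))"
    by (simp add: sum_distrib_left flip: complex_norm_square)
  finally show ?thesis by (simp only: of_real_eq_iff)
qed

lemma weighted_mean_add:
  assumes "continuous_on {0..2*pi} f" "continuous_on {0..2*pi} g"
  shows "weighted_mean n r (\<lambda>t. f t + g t) = weighted_mean n r f + weighted_mean n r g"
  unfolding weighted_mean_def distrib_right by (intro mean_add continuous_intros assms)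

lemma weighted_mean_mult_left: "weighted_mean n r (\<lambda>t. c * f t) = c * weighted_mean n r f"
  unfolding weighted_mean_def mult.assoc by (rule mean_mult_left)

lemma weighted_mean_sum:
  assumes "finite S" "\<And>k. k \<in> S \<Longrightarrow> continuous_on {0..2*pi} (f k)"
  shows "weighted_mean n r (\<lambda>t. \<Sum>k\<in>S. f k t) = (\<Sum>k\<in>S. weighted_mean n r (f k))"
  unfolding weighted_mean_def sum_distrib_right by (intro mean_sum continuous_intros assms)

lemma weighted_mean_mono:
  assumes "continuous_on {0..2*pi} f" "continuous_on {0..2*pi} g"
    and "\<And>t. t \<in> {0..2*pi} \<Longrightarrow> f t \<le> g t"
  shows "weighted_mean n r f \<le> weighted_mean n r g"
  unfolding weighted_mean_def by (intro mean_mono continuous_intros assms mult_right_mono) auto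

lemma LPO_of_real:
  assumes "continuous_on {0..2*pi} h"
  shows "LPO n w (\<lambda>t. of_real (h t)) s = of_real (weighted_mean n (\<lambda>j. w j s) h)"
  unfolding toeplitz_quadratic_form[OF assms, symmetric] LPO_def row_fun_def toeplitz_def
  by (simp add: scalar_prod_def sum_distrib_left mult_ac atLeast0LessThan)

section \<open>Singular values and the Frobenius norm\<close>

lemma dim_mat_adjoint [simp]: "dim_row (mat_adjoint A) = dim_col A" "dim_col (mat_adjoint A) = dim_row A"
  by (simp_all add: mat_adjoint_def)

lemma index_mat_adjoint [simp]:
  fixes A :: "complex mat"
  assumes "i < dim_col A" "j < dim_row A"
  shows "mat_adjoint A $$ (i,j) = cnj (A $$ (j,i))"
  using assms by (simp add: mat_adjoint_def mat_of_rows_index)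

lemma mat_adjoint_carrier [simp]: "A \<in> carrier_mat m n \<Longrightarrow> mat_adjoint A \<in> carrier_mat n m"
  by (intro carrier_matI) auto

lemma mat_adjoint_mult:
  fixes A B :: "complex mat"
  assumes "A \<in> carrier_mat m n" "B \<in> carrier_mat n p"
  shows "mat_adjoint (A * B) = mat_adjoint B * mat_adjoint A"
proof (rule eq_matI)
  fix i j assume "i < dim_row (mat_adjoint B * mat_adjoint A)" "j < dim_col (mat_adjoint B * mat_adjoint A)"
  then have ij: "i < p" "j < m" using assms by auto
  have "mat_adjoint (A * B) $$ (i,j) = cnj (\<Sum>k = 0..<n. A $$ (j,k) * B $$ (k,i))"
    using assms ij by (simp add: scalar_prod_def)
  also have "\<dots> = (\<Sum>k = 0..<n. cnj (B $$ (k,i)) * cnj (A $$ (j,k)))"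
    by (simp add: mult.commute)
  also have "\<dots> = (mat_adjoint B * mat_adjoint A) $$ (i,j)"
    using assms ij by (simp add: scalar_prod_def)
  finally show "mat_adjoint (A * B) $$ (i,j) = (mat_adjoint B * mat_adjoint A) $$ (i,j)" .
qed (use assms in auto)

lemma mat_adjoint_adjoint [simp]: "mat_adjoint (mat_adjoint A) = (A :: complex mat)"
  by (intro eq_matI) auto

lemma similar_mat_trace:
  fixes A B :: "complex mat"
  assumes A: "A \<in> carrier_mat n n" and sim: "similar_mat_wit A B P Q"
  shows "(\<Sum>i<n. A $$ (i,i)) = (\<Sum>i<n. B $$ (i,i))"
proof -
  note w = similar_mat_witD2[OF A sim]
  have BQ: "B * Q \<in> carrier_mat n n" using w by auto
  have tr: "(\<Sum>i<n. (X * Y) $$ (i,i)) = (\<Sum>i<n. (Y * X) $$ (i,i))"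
    if "X \<in> carrier_mat n n" "Y \<in> carrier_mat n n" for X Y :: "complex mat"
  proof -
    have "(\<Sum>i<n. (X * Y) $$ (i,i)) = (\<Sum>i<n. \<Sum>k<n. X $$ (i,k) * Y $$ (k,i))"
      using that by (auto simp: scalar_prod_def atLeast0LessThan intro!: sum.cong)
    also have "\<dots> = (\<Sum>k<n. \<Sum>i<n. Y $$ (k,i) * X $$ (i,k))"
      by (subst sum.swap) (simp add: mult.commute)
    also have "\<dots> = (\<Sum>i<n. (Y * X) $$ (i,i))"
      using that by (auto simp: scalar_prod_def atLeast0LessThan intro!: sum.cong)
    finally show ?thesis .
  qed
  have "(\<Sum>i<n. A $$ (i,i)) = (\<Sum>i<n. (P * (B * Q)) $$ (i,i))"
    using w by (simp add: assoc_mult_mat[of P n n B n Q n])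
  also have "\<dots> = (\<Sum>i<n. (B * Q * P) $$ (i,i))" using tr[OF w(6) BQ] .
  also have "B * Q * P = B" using w by (simp add: assoc_mult_mat[of B n n Q n P n])
  finally show ?thesis .
qed

text \<open>
  Schur's triangular form carries the eigenvalues on its diagonal, and similarity preserves the
  trace.
\<close>

lemma sum_proots_char_poly:
  fixes A :: "complex mat"
  assumes A: "A \<in> carrier_mat n n"
  shows "(\<Sum>z\<in>#proots (char_poly A). z) = (\<Sum>i<n. A $$ (i,i))"
proof -
  obtain as where as: "char_poly A = (\<Prod>a\<leftarrow>as. [:- a, 1:])"
    using char_poly_factorized[OF A] by blast
  obtain B P Q where BPQ: "schur_decomposition A as = (B, P, Q)" by (metis prod_cases3)
  have sim: "similar_mat_wit A B P Q" and dg: "diag_mat B = as"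
    using schur_decomposition[OF A as BPQ] by auto
  have B: "B \<in> carrier_mat n n" using similar_mat_witD2[OF A sim] by auto
  have "proots (\<Prod>a\<leftarrow>bs. [:- a, 1:]) = mset bs" for bs :: "complex list"
  proof (induction bs)
    case (Cons b bs)
    have "(\<Prod>a\<leftarrow>bs. [:- a, 1:]) \<noteq> 0"
      by (induction bs) (simp_all del: mult_pCons_left)
    then have "proots ([:- b, 1:] * (\<Prod>a\<leftarrow>bs. [:- a, 1:])) = proots [:- b, 1:] + mset bs"
      using Cons.IH by (subst proots_mult) auto
    then show ?case by simp
  qed simp
  then have "proots (char_poly A) = mset as" by (simp only: as)
  then have "(\<Sum>z\<in>#proots (char_poly A). z) = sum_list as"
    by (simp add: sum_mset_sum_list)
  also have "\<dots> = (\<Sum>i<n. B $$ (i,i))"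
    using B unfolding dg[symmetric] diag_mat_def by (simp add: sum_list_sum_nth atLeast0LessThan)
  finally show ?thesis using similar_mat_trace[OF A sim] by simp
qed

text \<open>
  If \<open>E\<^sup>* E u = z u\<close>, then \<open>z \<parallel>u\<parallel>\<^sup>2 = \<parallel>E u\<parallel>\<^sup>2\<close>.
\<close>

lemma proots_gram_nonneg:
  fixes E :: "complex mat"
  assumes E: "E \<in> carrier_mat n n" and z: "z \<in># proots (char_poly (mat_adjoint E * E))"
  shows "Re z \<ge> 0"
proof -
  let ?G = "mat_adjoint E * E"
  have G: "?G \<in> carrier_mat n n" using E by auto
  have "poly (char_poly ?G) z = 0" using z
    by (metis count_proots not_in_iff order_root proots_0 set_mset_empty empty_iff)
  then have "eigenvalue ?G z" using eigenvalue_root_char_poly[OF G] by simp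
  then obtain u where u: "u \<in> carrier_vec n" "u \<noteq> 0\<^sub>v n" "?G *\<^sub>v u = z \<cdot>\<^sub>v u"
    unfolding eigenvalue_def eigenvector_def using E by auto
  define y where "y = E *\<^sub>v u"
  have y: "y \<in> carrier_vec n" using E u by (simp add: y_def)
  have Gu: "mat_adjoint E *\<^sub>v y = z \<cdot>\<^sub>v u"
    using u E by (simp add: y_def assoc_mult_mat_vec[of "mat_adjoint E" n n E n u])
  have ent: "(\<Sum>j<n. cnj (E $$ (j,i)) * (y $ j)) = z * (u $ i)" if "i < n" for i
  proof -
    have "(mat_adjoint E *\<^sub>v y) $ i = (\<Sum>j<n. cnj (E $$ (j,i)) * (y $ j))"
      using E y that by (simp add: scalar_prod_def atLeast0LessThan)
    then show ?thesis unfolding Gu using u that by simp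
  qed
  have yj: "y $ j = (\<Sum>i<n. E $$ (j,i) * (u $ i))" if "j < n" for j
    using E u that by (simp add: y_def scalar_prod_def atLeast0LessThan)
  define a where "a = (\<Sum>i<n. (cmod (u $ i))\<^sup>2)"
  define b where "b = (\<Sum>i<n. (cmod (y $ i))\<^sup>2)"
  have "z * of_real a = (\<Sum>i<n. cnj (u $ i) * (z * (u $ i)))"
    by (simp add: a_def sum_distrib_left complex_norm_square mult_ac del: of_real_power)
  also have "\<dots> = (\<Sum>i<n. \<Sum>j<n. cnj (E $$ (j,i) * (u $ i)) * (y $ j))"
    by (simp add: ent[symmetric] sum_distrib_left mult_ac)
  also have "\<dots> = (\<Sum>j<n. cnj (y $ j) * (y $ j))"
    by (subst sum.swap) (simp add: yj sum_distrib_right)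
  also have "\<dots> = of_real b"
    by (simp add: b_def complex_norm_square mult_ac del: of_real_power)
  finally have zab: "z * of_real a = of_real b" .
  obtain i where "i < n" "u $ i \<noteq> 0" using u by (metis carrier_vecD eq_vecI index_zero_vec)
  then have "a > 0" unfolding a_def
    by (intro sum_pos2[of _ i]) auto
  moreover have "b \<ge> 0" unfolding b_def by (simp add: sum_nonneg)
  ultimately have "z = of_real (b / a)" using zab by (simp add: field_simps)
  then show "Re z \<ge> 0" using \<open>a > 0\<close> \<open>b \<ge> 0\<close> by simp
qed

text \<open>
  Chebyshev's inequality for singular values: their squares add up to the trace of \<open>E\<^sup>* E\<close>, which is
  the squared Frobenius norm, and each counted one contributes at least \<open>\<epsilon>\<^sup>2\<close>.
\<close>

lemma singular_values_count_le:
  fixes E :: "complex mat"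
  assumes E: "E \<in> carrier_mat n n" and \<epsilon>: "\<epsilon> > 0"
  shows "\<epsilon>\<^sup>2 * real (size {#s \<in># singular_values E. s \<notin> {0..<\<epsilon>}#})
    \<le> (\<Sum>i<n. \<Sum>j<n. (cmod (E $$ (i,j)))\<^sup>2)"
proof -
  let ?G = "mat_adjoint E * E"
  let ?R = "proots (char_poly ?G)"
  have G: "?G \<in> carrier_mat n n" using E by auto
  have sub: "\<epsilon>\<^sup>2 * real (size {#s \<in># image_mset (\<lambda>z. sqrt (Re z)) M. s \<notin> {0..<\<epsilon>}#}) \<le> (\<Sum>z\<in>#M. Re z)"
    if "\<And>z. z \<in># M \<Longrightarrow> Re z \<ge> 0" for M
    using that
  proof (induction M)
    case (add z M)
    have IH: "\<epsilon>\<^sup>2 * real (size {#s \<in># image_mset (\<lambda>z. sqrt (Re z)) M. s \<notin> {0..<\<epsilon>}#}) \<le> (\<Sum>z\<in>#M. Re z)"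
      using add by auto
    have z: "Re z \<ge> 0" using add by auto
    show ?case
    proof (cases "sqrt (Re z) < \<epsilon>")
      case True
      then show ?thesis using IH z by simp
    next
      case False
      then have "\<epsilon>\<^sup>2 \<le> (sqrt (Re z))\<^sup>2" using \<epsilon> by (intro power_mono) auto
      then show ?thesis using IH z False by (simp add: algebra_simps)
    qed
  qed auto
  have "\<epsilon>\<^sup>2 * real (size {#s \<in># singular_values E. s \<notin> {0..<\<epsilon>}#}) \<le> (\<Sum>z\<in>#?R. Re z)"
    unfolding singular_values_def by (rule sub) (rule proots_gram_nonneg[OF E])
  also have "\<dots> = Re (\<Sum>z\<in>#?R. z)"
  proof -
    have "(\<Sum>z\<in>#M. Re z) = Re (\<Sum>z\<in>#M. z)" for M by (induction M) auto
    then show ?thesis .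
  qed
  also have "(\<Sum>z\<in>#?R. z) = (\<Sum>i<n. ?G $$ (i,i))"
    by (rule sum_proots_char_poly[OF G])
  also have "\<dots> = (\<Sum>i<n. \<Sum>j<n. of_real ((cmod (E $$ (j,i)))\<^sup>2))"
    using E by (intro sum.cong refl)
      (simp add: scalar_prod_def atLeast0LessThan complex_norm_square mult.commute del: of_real_power)
  also have "Re \<dots> = (\<Sum>i<n. \<Sum>j<n. (cmod (E $$ (j,i)))\<^sup>2)"
    by simp
  also have "\<dots> = (\<Sum>i<n. \<Sum>j<n. (cmod (E $$ (i,j)))\<^sup>2)"
    by (rule sum.swap)
  finally show ?thesis .
qed

lemma singular_values_unitary_conj:
  fixes X V :: "complex mat"
  assumes X: "X \<in> carrier_mat n n" and V: "V \<in> carrier_mat n n"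
    and unitary: "unitary_mat V"
  shows "singular_values (mat_adjoint V * X * V) = singular_values X"
proof -
  define W where "W = mat_adjoint V"
  have W: "W \<in> carrier_mat n n" using V by (simp add: W_def)
  have WV: "W * V = 1\<^sub>m n" "V * W = 1\<^sub>m n"
    using unitary V by (auto simp: unitary_mat_def W_def)
  define Y where "Y = mat_adjoint X"
  have Y: "Y \<in> carrier_mat n n" using X by (simp add: Y_def)
  have adj: "mat_adjoint (W * X * V) = W * Y * V"
  proof -
    have "mat_adjoint (W * X * V) = W * mat_adjoint (W * X)"
      unfolding W_def by (rule mat_adjoint_mult[of _ n n _ n]) (use X V in auto)
    also have "mat_adjoint (W * X) = Y * mat_adjoint W"
      unfolding Y_def by (rule mat_adjoint_mult[of _ n n _ n]) (use X W in auto)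
    also have "mat_adjoint W = V" by (simp add: W_def)
    also have "W * (Y * V) = W * Y * V"
      using assoc_mult_mat[OF W Y V] by simp
    finally show ?thesis .
  qed
  have cancel: "V * (W * Z) = Z" if "Z \<in> carrier_mat n n" for Z
    using assoc_mult_mat[OF V W that] WV that by simp
  have "mat_adjoint (W * X * V) * (W * X * V) = W * (Y * X) * V"
    unfolding adj using X Y V W by (simp add: assoc_mult_mat[of _ n n _ n _ n] cancel)
  then have "similar_mat (mat_adjoint (W * X * V) * (W * X * V)) (Y * X)"
    using X Y V W WV by (intro similar_matI[where n = n and P = W and Q = V]) auto
  then show ?thesis
    unfolding singular_values_def W_def[symmetric] Y_def[symmetric] by (simp add: char_poly_similar)
qed

text \<open>
  In the orthonormal basis given by the columns of \<open>V\<^sup>*\<close> the preconditioner just deletes the off-diagonal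
  entries, so its error is, up to sign, the off-diagonal part of \<open>V T V\<^sup>*\<close>.
\<close>

lemma singular_values_precond_error:
  fixes T V :: "complex mat"
  assumes T: "T \<in> carrier_mat n n" and V: "V \<in> carrier_mat n n" and unitary: "unitary_mat V"
  shows "singular_values (precond (mat_adjoint V) T - T)
    = singular_values (diag_part (V * T * mat_adjoint V) - V * T * mat_adjoint V)"
proof -
  define W where "W = mat_adjoint V"
  have W: "W \<in> carrier_mat n n" using V by (simp add: W_def)
  have WV: "W * V = 1\<^sub>m n" "V * W = 1\<^sub>m n"
    using unitary V by (auto simp: unitary_mat_def W_def)
  define B where "B = V * T * W"
  have B: "B \<in> carrier_mat n n" using V T W by (simp add: B_def)
  have D: "diag_part B \<in> carrier_mat n n" using B by (simp add: diag_part_def)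
  have "W * B * V = (W * V) * T * (W * V)"
    using V T W by (simp add: B_def assoc_mult_mat[of _ n n _ n _ n])
  then have WBV: "W * B * V = T" using WV T by simp
  have "W * (diag_part B - B) * V = W * diag_part B * V - W * B * V"
    using W V B D by (simp add: mult_minus_distrib_mat[of _ n n _ n] minus_mult_distrib_mat[of _ n n _ _ n])
  then have "precond W T - T = W * (diag_part B - B) * V"
    using WBV by (simp add: precond_def W_def B_def)
  moreover have "diag_part B - B \<in> carrier_mat n n" using B by (simp add: minus_carrier_mat)
  ultimately show ?thesis
    using singular_values_unitary_conj[OF _ V unitary, of "diag_part B - B"]
    by (simp add: W_def B_def)
qed

lemma gram_diag:
  fixes X :: "complex mat"
  assumes X: "X \<in> carrier_mat n n" and i: "i < n"
  shows "(X * mat_adjoint X) $$ (i,i) = of_real (\<Sum>j<n. (cmod (X $$ (i,j)))\<^sup>2)"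
  using assms
  by (simp add: scalar_prod_def atLeast0LessThan complex_norm_square del: of_real_power)

text \<open>
  Subtracting \<open>c I\<close> from \<open>T\<close> changes only the diagonal of \<open>V T V\<^sup>*\<close>, so the constant \<open>c\<close> is free and may
  depend on the row. After the shift the diagonal entry is added back, and the unitary factor
  \<open>V\<^sup>*\<close> on the right is removed because it preserves the norm of a row.
\<close>

lemma offdiag_row_bound:
  fixes T V :: "complex mat"
  assumes T: "T \<in> carrier_mat n n" and V: "V \<in> carrier_mat n n" and unitary: "unitary_mat V"
    and i: "i < n"
  defines "B \<equiv> V * T * mat_adjoint V"
  shows "(\<Sum>j<n. (cmod ((diag_part B - B) $$ (i,j)))\<^sup>2)
    \<le> (\<Sum>j<n. (cmod ((V * (T - c \<cdot>\<^sub>m 1\<^sub>m n)) $$ (i,j)))\<^sup>2)"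
proof -
  define W where "W = mat_adjoint V"
  have W: "W \<in> carrier_mat n n" using V by (simp add: W_def)
  have WV: "W * V = 1\<^sub>m n" "V * W = 1\<^sub>m n"
    using unitary V by (auto simp: unitary_mat_def W_def)
  define C where "C = V * (T - c \<cdot>\<^sub>m 1\<^sub>m n)"
  have C: "C \<in> carrier_mat n n" using V T by (auto simp: C_def)
  have B: "B \<in> carrier_mat n n" using V T by (auto simp: B_def)
  have "C = V * T - c \<cdot>\<^sub>m V"
    unfolding C_def using V T
    by (subst mult_minus_distrib_mat[of _ n n _ n]) (auto simp: mult_smult_distrib[of _ n n _ n])
  then have "C * W = V * T * W - c \<cdot>\<^sub>m V * W"
    using V T W by (simp add: minus_mult_distrib_mat[of _ n n _ _ n])
  also have "c \<cdot>\<^sub>m V * W = c \<cdot>\<^sub>m 1\<^sub>m n"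
    using mult_smult_assoc_mat[OF V W] WV by simp
  finally have CW: "C * W = B - c \<cdot>\<^sub>m 1\<^sub>m n" by (simp add: B_def W_def)
  have "(\<Sum>j<n. (cmod ((diag_part B - B) $$ (i,j)))\<^sup>2) \<le> (\<Sum>j<n. (cmod ((C * W) $$ (i,j)))\<^sup>2)"
    using B i unfolding CW by (intro sum_mono) (auto simp: diag_part_def norm_minus_commute)
  also have "\<dots> = (\<Sum>j<n. (cmod (C $$ (i,j)))\<^sup>2)"
  proof -
    have "(C * W) * mat_adjoint (C * W) = (C * W) * (V * mat_adjoint C)"
      using mat_adjoint_mult[OF C W] by (simp add: W_def)
    also have "\<dots> = C * (W * (V * mat_adjoint C))"
      using assoc_mult_mat[OF C W, of "V * mat_adjoint C" n] V C by simp
    also have "W * (V * mat_adjoint C) = mat_adjoint C"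
      using assoc_mult_mat[OF W V, of "mat_adjoint C" n] WV C by simp
    finally have "complex_of_real (\<Sum>j<n. (cmod ((C * W) $$ (i,j)))\<^sup>2) = of_real (\<Sum>j<n. (cmod (C $$ (i,j)))\<^sup>2)"
      using gram_diag[of "C * W" n i] gram_diag[OF C i] C W i by simp
    then show ?thesis by (simp only: of_real_eq_iff)
  qed
  finally show ?thesis by (simp add: C_def)
qed

section \<open>Uniformly small arrays and the sup norm\<close>

text \<open>
  Only upper bounds are recorded: the quantities to which this is applied are nonnegative.
\<close>

definition uniformly_vanishing :: "(nat \<Rightarrow> nat \<Rightarrow> real) \<Rightarrow> bool" where
  "uniformly_vanishing a \<longleftrightarrow> (\<forall>e>0. \<forall>\<^sub>F n in sequentially. \<forall>j<n. a n j \<le> e)"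

lemma uniformly_vanishing_mono:
  assumes "uniformly_vanishing b" "\<And>n j. j < n \<Longrightarrow> a n j \<le> b n j"
  shows "uniformly_vanishing a"
  unfolding uniformly_vanishing_def
proof (intro allI impI)
  fix e :: real assume "e > 0"
  with assms(1) have "\<forall>\<^sub>F n in sequentially. \<forall>j<n. b n j \<le> e"
    unfolding uniformly_vanishing_def by blast
  then show "\<forall>\<^sub>F n in sequentially. \<forall>j<n. a n j \<le> e"
    by eventually_elim (meson assms(2) order_trans)
qed

lemma uniformly_vanishing_0: "uniformly_vanishing (\<lambda>n j. 0)"
  by (simp add: uniformly_vanishing_def)

lemma uniformly_vanishing_add:
  assumes "uniformly_vanishing a" "uniformly_vanishing b"
  shows "uniformly_vanishing (\<lambda>n j. a n j + b n j)"
  unfolding uniformly_vanishing_def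
proof (intro allI impI)
  fix e :: real assume "e > 0"
  then have "\<forall>\<^sub>F n in sequentially. \<forall>j<n. a n j \<le> e/2" "\<forall>\<^sub>F n in sequentially. \<forall>j<n. b n j \<le> e/2"
    using assms unfolding uniformly_vanishing_def by (meson half_gt_zero)+
  then show "\<forall>\<^sub>F n in sequentially. \<forall>j<n. a n j + b n j \<le> e"
    by eventually_elim (metis add_mono field_sum_of_halves)
qed

lemma uniformly_vanishing_cmult:
  assumes "uniformly_vanishing a" "c \<ge> 0"
  shows "uniformly_vanishing (\<lambda>n j. c * a n j)"
proof (cases "c = 0")
  case False
  show ?thesis
    unfolding uniformly_vanishing_def
  proof (intro allI impI)
    fix e :: real assume "e > 0"
    then have "e / c > 0" using False assms(2) by simp
    then have "\<forall>\<^sub>F n in sequentially. \<forall>j<n. a n j \<le> e / c"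
      using assms(1) unfolding uniformly_vanishing_def by blast
    then show "\<forall>\<^sub>F n in sequentially. \<forall>j<n. c * a n j \<le> e"
      by eventually_elim (use False assms(2) in \<open>auto simp: field_simps\<close>)
  qed
qed (simp add: uniformly_vanishing_0)

lemma uniformly_vanishing_sum:
  assumes "finite S" "\<And>k. k \<in> S \<Longrightarrow> uniformly_vanishing (a k)"
  shows "uniformly_vanishing (\<lambda>n j. \<Sum>k\<in>S. a k n j)"
  using assms
  by (induction rule: finite_induct) (auto intro: uniformly_vanishing_0 uniformly_vanishing_add)

lemma C2pi_bounded:
  assumes "f \<in> C2pi"
  obtains K where "K > 0" "\<And>t. t \<in> {0..2*pi} \<Longrightarrow> cmod (f t) \<le> K"
proof -
  have "bounded (f ` {0..2*pi})"
    using assms by (intro compact_imp_bounded compact_continuous_image) (auto simp: C2pi_def)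
  then show ?thesis using that unfolding bounded_pos by blast
qed

lemma norm_le_sup_norm:
  assumes "f \<in> C2pi" "t \<in> {0..2*pi}"
  shows "cmod (f t) \<le> sup_norm f"
proof -
  obtain K where "\<And>t. t \<in> {0..2*pi} \<Longrightarrow> cmod (f t) \<le> K" using C2pi_bounded[OF assms(1)] by metis
  then have "bdd_above ((\<lambda>t. cmod (f t)) ` {0..2*pi})" by (intro bdd_aboveI2) auto
  then show ?thesis unfolding sup_norm_def using assms(2) by (intro cSUP_upper) auto
qed

lemma square_norm_sum2:
  fixes a b :: complex
  shows "(cmod (a + b))\<^sup>2 \<le> 2 * (cmod a)\<^sup>2 + 2 * (cmod b)\<^sup>2"
proof -
  have "(cmod (a + b))\<^sup>2 \<le> (cmod a + cmod b)\<^sup>2" by (simp add: norm_triangle_ineq power_mono)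
  also have "\<dots> \<le> 2 * (cmod a)\<^sup>2 + 2 * (cmod b)\<^sup>2"
    using zero_le_power2[of "cmod a - cmod b"] unfolding power2_sum power2_diff by linarith
  finally show ?thesis .
qed

section \<open>Concentrated functions\<close>

text \<open>
  At the grid points the operators \<open>L\<^sub>n\<close> are states: positive functionals that fix the constants,
  because the rows of a unitary matrix have norm one. Between the grid points \<open>L\<^sub>n(1)\<close> may differ
  from \<open>1\<close>, which is why everything is evaluated on the grid.
\<close>

locale grid_states =
  fixes v :: "nat \<Rightarrow> nat \<Rightarrow> real \<Rightarrow> complex" and x :: "nat \<Rightarrow> nat \<Rightarrow> real"
  assumes point: "j < n \<Longrightarrow> x n j \<in> {0..2*pi}"
    and unit_row: "j < n \<Longrightarrow> (\<Sum>k<n. (cmod (v n k (x n j)))\<^sup>2) = 1"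
begin

definition state :: "nat \<Rightarrow> nat \<Rightarrow> (real \<Rightarrow> real) \<Rightarrow> real" where
  "state n j = weighted_mean n (\<lambda>k. v n k (x n j))"

text \<open>
  The second moment of \<open>f\<close> about its value at the grid point, and not about its mean in the state.
  It measures how far the state is from evaluation at the grid point, and, in contrast to the
  difference \<open>L\<^sub>n(f)(y) - f(y)\<close>, its smallness passes from two functions to their product.
\<close>

definition spread :: "(real \<Rightarrow> complex) \<Rightarrow> nat \<Rightarrow> nat \<Rightarrow> real" where
  "spread f n j = state n j (\<lambda>t. (cmod (f t - f (x n j)))\<^sup>2)"

definition concentrated :: "(real \<Rightarrow> complex) set" where
  "concentrated = {f \<in> C2pi. uniformly_vanishing (spread f)}"

lemma state_const: "j < n \<Longrightarrow> state n j (\<lambda>_. c) = c"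
  by (simp add: state_def weighted_mean_const unit_row)

lemma state_add:
  assumes "continuous_on {0..2*pi} f" "continuous_on {0..2*pi} g"
  shows "state n j (\<lambda>t. f t + g t) = state n j f + state n j g"
  unfolding state_def by (intro weighted_mean_add assms)

lemma state_cmult: "state n j (\<lambda>t. c * f t) = c * state n j f"
  unfolding state_def by (rule weighted_mean_mult_left)

lemma state_mono:
  assumes "continuous_on {0..2*pi} f" "continuous_on {0..2*pi} g"
    and "\<And>t. t \<in> {0..2*pi} \<Longrightarrow> f t \<le> g t"
  shows "state n j f \<le> state n j g"
  unfolding state_def by (intro weighted_mean_mono assms)

lemma spread_le:
  assumes "F \<in> C2pi" "f \<in> C2pi" "h \<in> C2pi" and j: "j < n"
    and le: "\<And>t. t \<in> {0..2*pi} \<Longrightarrow> (cmod (F t - F (x n j)))\<^sup>2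
      \<le> a * (cmod (f t - f (x n j)))\<^sup>2 + b * (cmod (h t - h (x n j)))\<^sup>2 + c"
  shows "spread F n j \<le> a * spread f n j + b * spread h n j + c"
proof -
  have [continuous_intros]: "continuous_on {0..2*pi} F" "continuous_on {0..2*pi} f" "continuous_on {0..2*pi} h"
    using assms by (auto simp: C2pi_def)
  have "spread F n j \<le> state n j (\<lambda>t. a * (cmod (f t - f (x n j)))\<^sup>2 + b * (cmod (h t - h (x n j)))\<^sup>2 + c)"
    unfolding spread_def by (intro state_mono continuous_intros le)
  also have "\<dots> = state n j (\<lambda>t. a * (cmod (f t - f (x n j)))\<^sup>2) + state n j (\<lambda>t. b * (cmod (h t - h (x n j)))\<^sup>2)
      + state n j (\<lambda>_. c)"
    by (subst state_add, (intro continuous_intros)+, subst state_add, (intro continuous_intros)+, rule refl)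
  also have "\<dots> = a * spread f n j + b * spread h n j + c"
    by (simp add: spread_def state_cmult state_const[OF j])
  finally show ?thesis .
qed

lemma concentrated_sum:
  assumes f: "f \<in> concentrated" and h: "h \<in> concentrated"
  shows "(\<lambda>t. f t + h t) \<in> concentrated"
proof -
  have C: "f \<in> C2pi" "h \<in> C2pi" "(\<lambda>t. f t + h t) \<in> C2pi"
    using f h by (auto simp: concentrated_def C2pi_def intro!: continuous_intros)
  have "uniformly_vanishing (\<lambda>n j. 2 * spread f n j + 2 * spread h n j)"
    using f h by (intro uniformly_vanishing_add uniformly_vanishing_cmult) (auto simp: concentrated_def)
  moreover have "spread (\<lambda>t. f t + h t) n j \<le> 2 * spread f n j + 2 * spread h n j" if "j < n" for n j
  proof -
    have "(cmod ((f t + h t) - (f (x n j) + h (x n j))))\<^sup>2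
        \<le> 2 * (cmod (f t - f (x n j)))\<^sup>2 + 2 * (cmod (h t - h (x n j)))\<^sup>2 + 0" for t
      using square_norm_sum2[of "f t - f (x n j)" "h t - h (x n j)"] by (simp add: algebra_simps)
    then show ?thesis using spread_le[OF C(3,1,2) that, of 2 2 0] by simp
  qed
  ultimately show ?thesis
    using C(3) by (auto simp: concentrated_def intro: uniformly_vanishing_mono)
qed

text \<open>
  This rests on the Leibniz-type identity \<open>f h - f(y) h(y) = (f - f(y)) h + f(y) (h - h(y))\<close> with bounded
  factors \<open>h\<close> and \<open>f(y)\<close>.
\<close>

lemma concentrated_product:
  assumes f: "f \<in> concentrated" and h: "h \<in> concentrated"
  shows "(\<lambda>t. f t * h t) \<in> concentrated"
proof -
  have C: "f \<in> C2pi" "h \<in> C2pi" "(\<lambda>t. f t * h t) \<in> C2pi"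
    using f h by (auto simp: concentrated_def C2pi_def intro!: continuous_intros)
  obtain K where K: "K > 0" "\<And>t. t \<in> {0..2*pi} \<Longrightarrow> cmod (f t) \<le> K" using C2pi_bounded[OF C(1)] by metis
  obtain L where L: "L > 0" "\<And>t. t \<in> {0..2*pi} \<Longrightarrow> cmod (h t) \<le> L" using C2pi_bounded[OF C(2)] by metis
  have "uniformly_vanishing (\<lambda>n j. 2 * L\<^sup>2 * spread f n j + 2 * K\<^sup>2 * spread h n j)"
    using f h by (intro uniformly_vanishing_add uniformly_vanishing_cmult) (auto simp: concentrated_def)
  moreover have "spread (\<lambda>t. f t * h t) n j \<le> 2 * L\<^sup>2 * spread f n j + 2 * K\<^sup>2 * spread h n j" if j: "j < n" for n j
  proof -
    let ?y = "x n j"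
    have "(cmod (f t * h t - f ?y * h ?y))\<^sup>2
        \<le> 2 * L\<^sup>2 * (cmod (f t - f ?y))\<^sup>2 + 2 * K\<^sup>2 * (cmod (h t - h ?y))\<^sup>2 + 0" if t: "t \<in> {0..2*pi}" for t
    proof -
      have "(cmod (f t * h t - f ?y * h ?y))\<^sup>2 = (cmod ((f t - f ?y) * h t + f ?y * (h t - h ?y)))\<^sup>2"
        by (simp add: algebra_simps)
      also have "\<dots> \<le> 2 * (cmod (h t))\<^sup>2 * (cmod (f t - f ?y))\<^sup>2 + 2 * (cmod (f ?y))\<^sup>2 * (cmod (h t - h ?y))\<^sup>2"
        using square_norm_sum2[of "(f t - f ?y) * h t" "f ?y * (h t - h ?y)"]
        by (simp add: norm_mult power_mult_distrib mult_ac)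
      also have "\<dots> \<le> 2 * L\<^sup>2 * (cmod (f t - f ?y))\<^sup>2 + 2 * K\<^sup>2 * (cmod (h t - h ?y))\<^sup>2"
        using K L t point[OF j] by (intro add_mono mult_right_mono mult_left_mono power_mono) auto
      finally show ?thesis by simp
    qed
    then show ?thesis using spread_le[OF C(3,1,2) j, of "2 * L\<^sup>2" "2 * K\<^sup>2" 0] by simp
  qed
  ultimately show ?thesis
    using C(3) by (auto simp: concentrated_def intro: uniformly_vanishing_mono)
qed

lemma concentrated_const: "(\<lambda>_. c) \<in> concentrated"
proof -
  have "spread (\<lambda>_. c) n j = 0" for n j
    using state_cmult[of n j 0] by (simp add: spread_def)
  then have "spread (\<lambda>_. c) = (\<lambda>n j. 0)" by (intro ext)
  then show ?thesis by (simp add: concentrated_def C2pi_def uniformly_vanishing_0)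
qed

lemma concentrated_closed:
  assumes f: "f \<in> C2pi" and approx: "\<And>\<epsilon>. \<epsilon> > 0 \<Longrightarrow> \<exists>h\<in>concentrated. sup_norm (\<lambda>t. f t - h t) < \<epsilon>"
  shows "f \<in> concentrated"
proof -
  have "\<forall>\<^sub>F n in sequentially. \<forall>j<n. spread f n j \<le> e" if e: "e > 0" for e
  proof -
    \<comment> \<open>With approximation error \<open>d\<close> the difference \<open>f - h\<close> varies by at most \<open>2 d\<close>, which costs \<open>2 (2 d)\<^sup>2 = e/2\<close> in the spread.\<close>
    define d where "d = sqrt (e / 16)"
    have d: "d > 0" "8 * d\<^sup>2 = e / 2" using e by (simp_all add: d_def)
    obtain h where h: "h \<in> concentrated" and hd: "sup_norm (\<lambda>t. f t - h t) < d" using approx[OF d(1)] by auto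
    have C: "h \<in> C2pi" "(\<lambda>t. f t - h t) \<in> C2pi"
      using f h by (auto simp: concentrated_def C2pi_def intro!: continuous_intros)
    have fh: "cmod (f t - h t) \<le> d" if "t \<in> {0..2*pi}" for t
      using norm_le_sup_norm[OF C(2) that] hd by simp
    have le: "spread f n j \<le> 2 * spread h n j + 8 * d\<^sup>2" if j: "j < n" for n j
    proof -
      let ?y = "x n j"
      have "(cmod (f t - f ?y))\<^sup>2 \<le> 2 * (cmod (h t - h ?y))\<^sup>2 + 0 * (cmod (h t - h ?y))\<^sup>2 + 8 * d\<^sup>2" if t: "t \<in> {0..2*pi}" for t
      proof -
        have "cmod ((f t - h t) - (f ?y - h ?y)) \<le> d + d"
          using norm_triangle_ineq4[of "f t - h t" "f ?y - h ?y"] fh[OF t] fh[OF point[OF j]] by linarith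
        then have "(cmod ((f t - h t) - (f ?y - h ?y)))\<^sup>2 \<le> (d + d)\<^sup>2"
          by (intro power_mono) auto
        then have "2 * (cmod ((f t - h t) - (f ?y - h ?y)))\<^sup>2 \<le> 8 * d\<^sup>2"
          by (simp add: power2_eq_square algebra_simps)
        moreover have "f t - f ?y = (h t - h ?y) + ((f t - h t) - (f ?y - h ?y))" by simp
        ultimately show ?thesis
          using square_norm_sum2[of "h t - h ?y" "(f t - h t) - (f ?y - h ?y)"] by simp
      qed
      then show ?thesis using spread_le[OF f C(1) C(1) j, of 2 0 "8 * d\<^sup>2"] by simp
    qed
    have "e / 4 > 0" using e by simp
    then have "\<forall>\<^sub>F n in sequentially. \<forall>j<n. spread h n j \<le> e / 4"
      using h \<open>e / 4 > 0\<close> unfolding concentrated_def uniformly_vanishing_def by blast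
    then show ?thesis
    proof eventually_elim
      case (elim n)
      show ?case
      proof (intro allI impI)
        fix j assume "j < n"
        then show "spread f n j \<le> e" using le[of j n] elim d(2) by fastforce
      qed
    qed
  qed
  then show ?thesis using f by (auto simp: concentrated_def uniformly_vanishing_def)
qed

lemma cstar_subalgebra_concentrated: "cstar_subalgebra concentrated"
proof -
  have "(\<lambda>t. cnj (f t)) \<in> concentrated" if f: "f \<in> concentrated" for f
  proof -
    have "spread (\<lambda>t. cnj (f t)) = spread f"
      unfolding spread_def by (simp flip: complex_cnj_diff)
    then show ?thesis using f by (auto simp: concentrated_def C2pi_def intro!: continuous_intros)
  qed
  moreover have "(\<lambda>t. c * f t) \<in> concentrated" if "f \<in> concentrated" for c f
    using concentrated_product[OF concentrated_const that] .
  moreover have "concentrated \<subseteq> C2pi" by (auto simp: concentrated_def)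
  ultimately show ?thesis
    unfolding cstar_subalgebra_def
    using concentrated_sum concentrated_product concentrated_const concentrated_closed
    by auto
qed

text \<open>
  This is Korovkin's argument. Expanding the square about the grid point \<open>y\<close>, the total spread of the
  \<open>g\<^sub>l\<close> is the error of the state on \<open>\<Sum> g\<^sub>l\<^sup>2\<close> minus \<open>2 \<Sum> g\<^sub>l(y)\<close> times its error on \<open>g\<^sub>l\<close>. Since each
  summand of the total is nonnegative, the single test function \<open>\<Sum> g\<^sub>l\<^sup>2\<close> can stand in for all the
  squares \<open>g\<^sub>l\<^sup>2\<close>.
\<close>

lemma generators_concentrated:
  fixes g :: "nat \<Rightarrow> real \<Rightarrow> real"
  assumes S: "finite S" and g: "\<And>k. k \<in> S \<Longrightarrow> continuous_on {0..2*pi} (g k)"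
    and lin: "\<And>k. k \<in> S \<Longrightarrow> uniformly_vanishing (\<lambda>n j. \<bar>state n j (g k) - g k (x n j)\<bar>)"
    and sq: "uniformly_vanishing (\<lambda>n j. \<bar>state n j (\<lambda>t. \<Sum>k\<in>S. (g k t)\<^sup>2) - (\<Sum>k\<in>S. (g k (x n j))\<^sup>2)\<bar>)"
    and k: "k \<in> S"
  shows "(\<lambda>t. complex_of_real (g k t)) \<in> concentrated"
proof -
  have "\<exists>K>0. \<forall>t\<in>{0..2*pi}. \<bar>g l t\<bar> \<le> K" if "l \<in> S" for l
  proof -
    have "(\<lambda>t. complex_of_real (g l t)) \<in> C2pi"
      using g[OF that] by (auto simp: C2pi_def intro!: continuous_intros)
    from C2pi_bounded[OF this] show ?thesis by (metis norm_of_real)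
  qed
  then obtain K where K: "\<And>l. l \<in> S \<Longrightarrow> K l > 0" "\<And>l t. l \<in> S \<Longrightarrow> t \<in> {0..2*pi} \<Longrightarrow> \<bar>g l t\<bar> \<le> K l"
    by metis
  let ?Q = "\<lambda>t. \<Sum>l\<in>S. (g l t)\<^sup>2"
  let ?bound = "\<lambda>n j. \<bar>state n j ?Q - ?Q (x n j)\<bar> + (\<Sum>l\<in>S. 2 * K l * \<bar>state n j (g l) - g l (x n j)\<bar>)"
  have "uniformly_vanishing ?bound"
    by (intro uniformly_vanishing_add uniformly_vanishing_sum uniformly_vanishing_cmult sq lin S)
       (use K in \<open>auto intro: less_imp_le\<close>)
  moreover have "spread (\<lambda>t. complex_of_real (g k t)) n j \<le> ?bound n j" if j: "j < n" for n j
  proof -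
    let ?y = "x n j"
    have "spread (\<lambda>t. complex_of_real (g k t)) n j = state n j (\<lambda>t. (g k t - g k ?y)\<^sup>2)"
      unfolding spread_def by (simp flip: of_real_diff)
    also have "\<dots> \<le> state n j (\<lambda>t. \<Sum>l\<in>S. (g l t - g l ?y)\<^sup>2)"
      using k S by (intro state_mono continuous_intros g member_le_sum) auto
    also have "\<dots> = state n j (\<lambda>t. (?Q t + (\<Sum>l\<in>S. (- 2 * g l ?y) * g l t)) + ?Q ?y)"
      by (simp add: power2_diff sum.distrib sum_subtractf sum_negf algebra_simps)
    also have "\<dots> = state n j ?Q + state n j (\<lambda>t. \<Sum>l\<in>S. (- 2 * g l ?y) * g l t) + ?Q ?y"
      by (subst state_add, (intro continuous_intros g; assumption)+,
          subst state_add, (intro continuous_intros g; assumption)+, simp only: state_const[OF j])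
    also have "state n j (\<lambda>t. \<Sum>l\<in>S. (- 2 * g l ?y) * g l t) = (\<Sum>l\<in>S. (- 2 * g l ?y) * state n j (g l))"
      unfolding state_def
      by (subst weighted_mean_sum[OF S], (intro continuous_intros g; assumption), simp only: weighted_mean_mult_left)
    also have "state n j ?Q + (\<Sum>l\<in>S. (- 2 * g l ?y) * state n j (g l)) + ?Q ?y
      = (state n j ?Q - ?Q ?y) + (\<Sum>l\<in>S. (- 2 * g l ?y) * (state n j (g l) - g l ?y))"
      by (simp add: right_diff_distrib sum_subtractf power2_eq_square sum_negf mult.assoc flip: sum_distrib_left)
    also have "\<dots> \<le> ?bound n j"
    proof (intro add_mono sum_mono)
      fix l assume l: "l \<in> S"
      have "(- 2 * g l ?y) * (state n j (g l) - g l ?y) \<le> \<bar>(- 2 * g l ?y) * (state n j (g l) - g l ?y)\<bar>"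
        by (rule abs_ge_self)
      also have "\<dots> = 2 * \<bar>g l ?y\<bar> * \<bar>state n j (g l) - g l ?y\<bar>" by (simp add: abs_mult)
      also have "\<dots> \<le> 2 * K l * \<bar>state n j (g l) - g l ?y\<bar>"
        using K(2)[OF l point[OF j]] by (intro mult_right_mono) auto
      finally show "(- 2 * g l ?y) * (state n j (g l) - g l ?y) \<le> 2 * K l * \<bar>state n j (g l) - g l ?y\<bar>" .
    qed auto
    finally show ?thesis .
  qed
  moreover have "(\<lambda>t. complex_of_real (g k t)) \<in> C2pi"
    using g[OF k] by (auto simp: C2pi_def intro!: continuous_intros)
  ultimately show ?thesis by (auto simp: concentrated_def intro: uniformly_vanishing_mono)
qed

lemma state_test:
  fixes h :: "real \<Rightarrow> real"
  assumes h: "continuous_on {0..2*pi} h"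
    and lim: "uniform_limit {0..2*pi} (\<lambda>n. LPO n (v n) (\<lambda>t. complex_of_real (h t)))
        (\<lambda>t. complex_of_real (h t)) sequentially"
  shows "uniformly_vanishing (\<lambda>n j. \<bar>state n j h - h (x n j)\<bar>)"
  unfolding uniformly_vanishing_def
proof (intro allI impI)
  fix e :: real assume "e > 0"
  from uniform_limitD[OF lim this]
  show "\<forall>\<^sub>F n in sequentially. \<forall>j<n. \<bar>state n j h - h (x n j)\<bar> \<le> e"
  proof eventually_elim
    case (elim n)
    show ?case
    proof (intro allI impI)
      fix j assume "j < n"
      then have "dist (LPO n (v n) (\<lambda>t. complex_of_real (h t)) (x n j)) (complex_of_real (h (x n j))) < e"
        using elim point by blast
      then show "\<bar>state n j h - h (x n j)\<bar> \<le> e"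
        unfolding LPO_of_real[OF h] dist_of_real by (simp add: state_def dist_real_def)
    qed
  qed
qed

end

section \<open>Weak cluster of the preconditioned Toeplitz matrices\<close>

lemma toeplitz_minus_const:
  assumes "f \<in> C2pi"
  shows "toeplitz n f - c \<cdot>\<^sub>m 1\<^sub>m n = toeplitz n (\<lambda>t. f t - c)"
proof (rule eq_matI)
  fix i j assume ij: "i < dim_row (toeplitz n (\<lambda>t. f t - c))" "j < dim_col (toeplitz n (\<lambda>t. f t - c))"
  have "fourier_coeff (\<lambda>t. f t + (- c)) k = fourier_coeff f k + (if k = 0 then - c else 0)" for k
    using assms by (subst fourier_coeff_add) (auto simp: C2pi_def fourier_coeff_const)
  then show "(toeplitz n f - c \<cdot>\<^sub>m 1\<^sub>m n) $$ (i,j) = toeplitz n (\<lambda>t. f t - c) $$ (i,j)"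
    using ij by (auto simp: toeplitz_def)
qed (simp_all add: toeplitz_def)

lemma unitary_mat_row_norm:
  assumes "unitary_mat V" "V \<in> carrier_mat n n" "i < n"
  shows "(\<Sum>k<n. (cmod (V $$ (i,k)))\<^sup>2) = 1"
proof -
  have "V * mat_adjoint V = 1\<^sub>m n" using assms by (auto simp: unitary_mat_def)
  then have "complex_of_real (\<Sum>k<n. (cmod (V $$ (i,k)))\<^sup>2) = of_real 1"
    using gram_diag[OF assms(2,3)] assms(3) by simp
  then show ?thesis by (simp only: of_real_eq_iff)
qed

text \<open>
  The row of the error that belongs to the grid point \<open>y\<close> is estimated after subtracting the constant
  \<open>f(y)\<close> from the symbol; Bessel's inequality then bounds its norm by the spread of \<open>f\<close> at \<open>y\<close>.
\<close>

lemma (in grid_states) singular_values_count_le_spread: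
  assumes f: "f \<in> C2pi" and \<epsilon>: "\<epsilon> > 0" and unitary: "unitary_mat (vandermonde n (v n) (x n))"
  defines "E \<equiv> precond (mat_adjoint (vandermonde n (v n) (x n))) (toeplitz n f) - toeplitz n f"
  shows "\<epsilon>\<^sup>2 * real (size {#s \<in># singular_values E. s \<notin> {0..<\<epsilon>}#}) \<le> (\<Sum>i<n. spread f n i)"
proof -
  define V where "V = vandermonde n (v n) (x n)"
  define T where "T = toeplitz n f"
  define B where "B = V * T * mat_adjoint V"
  have V: "V \<in> carrier_mat n n" and T: "T \<in> carrier_mat n n"
    by (simp_all add: V_def T_def vandermonde_def toeplitz_def)
  have U: "unitary_mat V" using unitary by (simp add: V_def)
  have "B \<in> carrier_mat n n" using V T by (auto simp: B_def)
  then have B: "diag_part B - B \<in> carrier_mat n n" by (rule minus_carrier_mat)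
  have "singular_values E = singular_values (diag_part B - B)"
    using singular_values_precond_error[OF T V U] by (simp add: E_def V_def T_def B_def)
  then have "\<epsilon>\<^sup>2 * real (size {#s \<in># singular_values E. s \<notin> {0..<\<epsilon>}#})
      \<le> (\<Sum>i<n. \<Sum>j<n. (cmod ((diag_part B - B) $$ (i,j)))\<^sup>2)"
    using singular_values_count_le[OF B \<epsilon>] by simp
  also have "\<dots> \<le> (\<Sum>i<n. spread f n i)"
  proof (rule sum_mono)
    fix i assume "i \<in> {..<n}"
    then have i: "i < n" by simp
    define c where "c = f (x n i)"
    have "(\<Sum>j<n. (cmod ((diag_part B - B) $$ (i,j)))\<^sup>2)
        \<le> (\<Sum>l<n. (cmod ((V * (T - c \<cdot>\<^sub>m 1\<^sub>m n)) $$ (i,l)))\<^sup>2)"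
      unfolding B_def by (rule offdiag_row_bound[OF T V U i])
    also have "\<dots> = (\<Sum>l<n. (cmod (\<Sum>k<n. v n k (x n i) * fourier_coeff (\<lambda>t. f t - c) (int k - int l)))\<^sup>2)"
      using i unfolding T_def toeplitz_minus_const[OF f]
      by (simp add: V_def vandermonde_def toeplitz_def scalar_prod_def atLeast0LessThan)
    also have "\<dots> \<le> spread f n i"
      unfolding spread_def state_def c_def
      using f by (intro toeplitz_row_bound continuous_intros) (auto simp: C2pi_def)
    finally show "(\<Sum>j<n. (cmod ((diag_part B - B) $$ (i,j)))\<^sup>2) \<le> spread f n i" .
  qed
  finally show ?thesis .
qed

lemma (in grid_states) weak_cluster_concentrated:
  assumes f: "f \<in> concentrated" and unitary: "\<And>n. unitary_mat (vandermonde n (v n) (x n))"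
  shows "weak_cluster (\<lambda>n. precond (mat_adjoint (vandermonde n (v n) (x n))) (toeplitz n f)) (\<lambda>n. toeplitz n f)"
  unfolding weak_cluster_def
proof (intro allI impI)
  fix \<epsilon> :: real assume \<epsilon>: "\<epsilon> > 0"
  define E where "E n = precond (mat_adjoint (vandermonde n (v n) (x n))) (toeplitz n f) - toeplitz n f" for n
  define N where "N n = size {#s \<in># singular_values (E n). s \<notin> {0..<\<epsilon>}#}" for n
  have "(\<lambda>n. real (N n)) \<in> o(\<lambda>n. real n)"
  proof (rule landau_o.smallI)
    fix c :: real assume c: "c > 0"
    then have "\<forall>\<^sub>F n in sequentially. \<forall>j<n. spread f n j \<le> c * \<epsilon>\<^sup>2"
      using f \<epsilon> unfolding concentrated_def uniformly_vanishing_def by simp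
    then show "\<forall>\<^sub>F n in sequentially. norm (real (N n)) \<le> c * norm (real n)"
    proof eventually_elim
      case (elim n)
      have "\<epsilon>\<^sup>2 * real (N n) \<le> (\<Sum>i<n. spread f n i)"
        unfolding N_def E_def using f \<epsilon> unitary
        by (intro singular_values_count_le_spread) (auto simp: concentrated_def)
      also have "\<dots> \<le> (\<Sum>i<n. c * \<epsilon>\<^sup>2)" using elim by (intro sum_mono) auto
      also have "\<dots> = \<epsilon>\<^sup>2 * (c * real n)" by simp
      finally show ?case using \<epsilon> by simp
    qed
  qed
  then show "\<exists>N1 N2. (\<lambda>n. real (N1 n)) \<in> o(\<lambda>n. real n) \<and>
      (\<forall>n>N2. size {#s \<in># singular_values (precond (mat_adjoint (vandermonde n (v n) (x n))) (toeplitz n f) - toeplitz n f).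
        s \<notin> {0..<\<epsilon>}#} \<le> N1 n)"
    by (intro exI[of _ N] exI[of _ 0]) (auto simp: N_def E_def)
qed

theorem theorem5p1:
  fixes v :: "nat \<Rightarrow> nat \<Rightarrow> real \<Rightarrow> complex"
    and x :: "nat \<Rightarrow> nat \<Rightarrow> real"
    and I :: "real set"
    and U :: "nat \<Rightarrow> complex mat"
    and m :: nat
    and g :: "nat \<Rightarrow> real \<Rightarrow> real"
  assumes trig: "\<And>n j. j < n \<Longrightarrow> trig_poly (v n j)"
    and interval: "is_interval I" "I \<subseteq> {0..2*pi}"
    and grid: "\<And>n. x n ` {..<n} \<subseteq> I" "\<And>n. inj_on (x n) {..<n}"
    and unitary: "\<And>n. unitary_mat (vandermonde n (v n) (x n))"
    and U_def: "\<And>n. U n = mat_adjoint (vandermonde n (v n) (x n))"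
    and norm_le_1: "\<And>n f. f \<in> C2pi \<Longrightarrow> sup_norm (LPO n (v n) f) \<le> sup_norm f"
    and m: "m \<ge> 1"
    and g_cont: "\<And>k. k \<in> {1..m} \<Longrightarrow> continuous_on {0..2*pi} (g k)"
    and test: "\<And>h :: real \<Rightarrow> real. h \<in> insert (\<lambda>t. \<Sum>k=1..m. (g k t)\<^sup>2) (g ` {1..m}) \<Longrightarrow>
      uniform_limit {0..2*pi} (\<lambda>n. LPO n (v n) (\<lambda>t. complex_of_real (h t)))
        (\<lambda>t. complex_of_real (h t)) sequentially"
  shows "\<forall>f \<in> cstar_generated ((\<lambda>k t. complex_of_real (g k t)) ` {1..m}).
    weak_cluster (\<lambda>n. precond (U n) (toeplitz n f)) (\<lambda>n. toeplitz n f)"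
proof
  fix f assume f: "f \<in> cstar_generated ((\<lambda>k t. complex_of_real (g k t)) ` {1..m})"
  have row: "(\<Sum>k<n. (cmod (v n k (x n j)))\<^sup>2) = 1" if "j < n" for n j
    using unitary_mat_row_norm[OF unitary[of n], of n j] that by (simp add: vandermonde_def)
  interpret grid_states v x
    by standard (use grid(1) interval(2) row in blast)+
  have "(\<lambda>t. complex_of_real (g k t)) \<in> concentrated" if "k \<in> {1..m}" for k
  proof (rule generators_concentrated[OF _ g_cont _ _ that])
    show "uniformly_vanishing (\<lambda>n j. \<bar>state n j (g k) - g k (x n j)\<bar>)" if "k \<in> {1..m}" for k
      using that by (intro state_test g_cont test) auto
    show "uniformly_vanishing (\<lambda>n j. \<bar>state n j (\<lambda>t. \<Sum>k=1..m. (g k t)\<^sup>2) - (\<Sum>k=1..m. (g k (x n j))\<^sup>2)\<bar>)"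
      by (intro state_test[where h = "\<lambda>t. \<Sum>k=1..m. (g k t)\<^sup>2"] continuous_intros g_cont test) auto
  qed auto
  then have "cstar_generated ((\<lambda>k t. complex_of_real (g k t)) ` {1..m}) \<subseteq> concentrated"
    unfolding cstar_generated_def by (intro hull_minimal cstar_subalgebra_concentrated) auto
  then show "weak_cluster (\<lambda>n. precond (U n) (toeplitz n f)) (\<lambda>n. toeplitz n f)"
    unfolding U_def using f unitary by (intro weak_cluster_concentrated) auto
qed

end
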